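(* Suppose that an $L$-function $L(s,\chi_k)$ belonging to a non-principal character $\chi_k$ modulo $k$ has a zero $s_0=1-\gamma+it$ with $\gamma<\frac14$ if $\chi_k$ is real, or $\gamma\le\frac18$ if $\chi_k$ is complex, and that another $L$-function $L(s,\chi_D)$, belonging to a real non-principal character $\chi_D$ modulo $D$ for which $\chi_k\chi_D$ is also non-principal, has a real exceptional zero $1-\delta$. Then the inequality $$\delta>\frac{c_1}{U^{b\gamma}\log^{5}U}\qquad\text{for}\quad \frac{1}{2(1-3\gamma)}<b<\frac{1}{2\gamma}$$ holds, where $U=k|s_0|D$.
   Context: $L(s,\chi)$ denotes the Dirichlet $L$-function of $\chi$; $\gamma,t$ are real; a complex character is one that is not real-valued. The real exceptional zero $1-\delta$ of $L(s,\chi_D)$ means its greatest real zero. The constant $c_1>0$ is an effective constant with the following property: whenever $\chi_k$ is a non-principal character modulo $k$ such that $L(s,\chi_k)$ has a zero $s_0=1-\gamma+it$ with $0<\gamma<\frac14$ if $\chi_k$ is real, or $0<\gamma\le\frac18$ if $\chi_k$ is complex, and $\chi_D$ is a real non-principal character modulo $D$ with $\chi_k\chi_D$ non-principal, one has $L(1,\chi_D)\ge \dfrac{c_1}{U^{b\gamma}\log^3U}$ for every $b$ with $\frac{1}{2(1-3\gamma)}<b<\frac1{2\gamma}$, where $U=k|s_0|D$. *)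

theory Defs
  imports "HOL-Complex_Analysis.Complex_Analysis"
begin

text \<open>
  Characters are functions on the natural numbers (rather than on residue classes);
  \<open>chi 1 = 1\<close> and \<open>norm (chi a) = 1\<close> for \<open>a\<close> coprime to \<open>n\<close> follow from the clauses below.
\<close>

definition dirichlet_character :: "nat \<Rightarrow> (nat \<Rightarrow> complex) \<Rightarrow> bool" where
  "dirichlet_character n chi \<longleftrightarrow>
     n > 0 \<and>
     (\<forall>a b. chi (a * b) = chi a * chi b) \<and>
     (\<forall>a. chi (a + n) = chi a) \<and>
     (\<forall>a. chi a \<noteq> 0 \<longleftrightarrow> coprime a n)"

definition principal_character :: "nat \<Rightarrow> (nat \<Rightarrow> complex) \<Rightarrow> bool" where
  "principal_character n chi \<longleftrightarrow> (\<forall>a. chi a = (if coprime a n then 1 else 0))"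

definition real_character :: "(nat \<Rightarrow> complex) \<Rightarrow> bool" where
  "real_character chi \<longleftrightarrow> (\<forall>a. chi a \<in> \<real>)"

text \<open>
  The analytically continued L-function of a character \<open>chi\<close> modulo \<open>n\<close>.  Its value at \<open>s\<close> is that
  of the continuation of the Dirichlet series to any half-plane containing \<open>s\<close>, minus the
  pole at \<open>1\<close> if \<open>chi\<close> is principal; it is unique by the identity theorem (and unspecified at
  the pole).  The term with \<open>m = 0\<close> vanishes because \<open>0 powr z = 0\<close>.
\<close>

definition dirichlet_L :: "nat \<Rightarrow> (nat \<Rightarrow> complex) \<Rightarrow> complex \<Rightarrow> complex" where
  "dirichlet_L n chi s =
     (THE w. \<exists>f c. c < Re s \<and>
        f holomorphic_on ({z. Re z > c} - (if principal_character n chi then {1} else {})) \<and>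
        (\<forall>z. Re z > 1 \<longrightarrow> (\<lambda>m. chi m * of_nat m powr (- z)) sums f z) \<and>
        w = f s)"

definition greatest_real_zero :: "(complex \<Rightarrow> complex) \<Rightarrow> real \<Rightarrow> bool" where
  "greatest_real_zero f \<beta> \<longleftrightarrow>
     f (of_real \<beta>) = 0 \<and> (\<forall>x::real. f (of_real x) = 0 \<longrightarrow> x \<le> \<beta>)"

text \<open>
  The property characterising the constant \<open>c\<^sub>1\<close>.  The product of the characters is
  considered as a character modulo \<open>k * D\<close>; and \<open>L(1, chiD)\<close> is real because
  \<open>chiD\<close> is, so that the real part below is the value itself.
\<close>

definition L1_bound_constant :: "real \<Rightarrow> bool" where
  "L1_bound_constant c\<^sub>1 \<longleftrightarrow>
     c\<^sub>1 > 0 \<and>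
     (\<forall>k D chik chiD \<gamma> t b s\<^sub>0 U.
        dirichlet_character k chik \<longrightarrow>
        \<not> principal_character k chik \<longrightarrow>
        s\<^sub>0 = Complex (1 - \<gamma>) t \<longrightarrow>
        dirichlet_L k chik s\<^sub>0 = 0 \<longrightarrow>
        0 < \<gamma> \<longrightarrow>
        (if real_character chik then \<gamma> < 1 / 4 else \<gamma> \<le> 1 / 8) \<longrightarrow>
        dirichlet_character D chiD \<longrightarrow>
        real_character chiD \<longrightarrow>
        \<not> principal_character D chiD \<longrightarrow>
        \<not> principal_character (k * D) (\<lambda>a. chik a * chiD a) \<longrightarrow>
        U = real k * cmod s\<^sub>0 * real D \<longrightarrow>
        1 / (2 * (1 - 3 * \<gamma>)) < b \<longrightarrow>
        b < 1 / (2 * \<gamma>) \<longrightarrow>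
        Re (dirichlet_L D chiD 1) \<ge> c\<^sub>1 / (U powr (b * \<gamma>) * ln U ^ 3))"

end

theory Submission
  imports Defs "HOL-Number_Theory.Number_Theory"
begin

text \<open>
  The hypothesis on \<open>c\<^sub>1\<close> bounds \<open>L(1, \<chi>\<^sub>D)\<close> from below by \<open>c\<^sub>1 / (U powr (b * \<gamma>) * ln U ^ 3)\<close>, and a zero
  \<open>1 - \<delta>\<close> close to 1 makes \<open>L(1, \<chi>\<^sub>D)\<close> small.  The theorem therefore follows from the strict upper bound
  \<open>L(1, \<chi>\<^sub>D) < \<delta> * (ln U)\<^sup>2\<close> (lemma \<open>dirichlet_L_1_less_of_zero\<close>), in which the constant has to be
  exactly 1.  It depends on \<open>U\<close> only through \<open>U \<ge> 9 / 4 * D\<close>, which holds because \<open>k \<ge> 3\<close> and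
  \<open>\<bar>s\<^sub>0\<bar> > 3 / 4\<close>.

  The usual argument, \<open>L(1) = \<delta> * L'(\<xi>)\<close> with \<open>L'(\<xi>) = O((ln D)\<^sup>2)\<close>, is carried out with explicit
  constants and without derivatives: \<open>L(1) = L(1) - L(1 - \<delta>)\<close> is minus the series of
  \<open>\<chi>(n) * (n powr \<delta> - 1) / n\<close>.  A sum of a nonprincipal character over any interval is at most \<open>D / 2\<close>
  in size, so Abel summation bounds this series by the sum of \<open>(n powr \<delta> - 1) / n\<close> over the first \<open>D / 2\<close> or
  so integers (lemma \<open>character_series_bound\<close>).  When \<open>\<delta> < 1 / ln U\<close>, the terms are at most
  \<open>2 * \<delta> * ln n / n\<close>, and their sum is \<open>\<delta> * (ln D)\<^sup>2\<close> up to smaller terms that the distance between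
  \<open>ln D\<close> and \<open>ln U\<close> absorbs.  For larger \<open>\<delta>\<close> the bound \<open>L(1) \<le> 1 + ln (D / 2)\<close> is enough.

  These arguments need the values of \<open>L\<close> as sums of its conditionally convergent series
  (lemma \<open>dirichlet_L_sums\<close>), and \<open>\<delta> > 0\<close>, which combines \<open>L(1) > 0\<close> with the nonvanishing
  of \<open>L\<close> to the right of 1 (lemma \<open>dirichlet_L_nonzero_right_of_1\<close>).
\<close>

section \<open>Dirichlet characters and their sums over intervals\<close>

lemma character_mod:
  assumes "dirichlet_character D chi"
  shows "chi (a mod D) = chi a"
proof -
  have "chi (r + q * D) = chi r" for r q
  proof (induction q)
    case (Suc q)
    have "chi (r + Suc q * D) = chi ((r + q * D) + D)"
      by (simp add: algebra_simps)
    also have "\<dots> = chi (r + q * D)"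
      using assms unfolding dirichlet_character_def by blast
    finally show ?case using Suc by simp
  qed simp
  from this[of "a mod D" "a div D"] show ?thesis by simp
qed

lemma character_one:
  assumes "dirichlet_character D chi"
  shows "chi 1 = 1"
proof -
  have "chi 1 * chi 1 = chi 1" "chi 1 \<noteq> 0"
    using assms unfolding dirichlet_character_def by (metis mult_1, simp)
  thus ?thesis by simp
qed

lemma character_power:
  assumes "dirichlet_character D chi"
  shows "chi (a ^ n) = chi a ^ n"
proof (induction n)
  case 0
  show ?case using character_one[OF assms] by simp
next
  case (Suc n)
  thus ?case using assms unfolding dirichlet_character_def by simp
qed

text \<open>
  By Euler's theorem the nonzero values are roots of unity.
\<close>

lemma norm_character_le_1:
  assumes "dirichlet_character D chi"
  shows "cmod (chi a) \<le> 1"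
proof (cases "coprime a D")
  case True
  have D: "D > 0" using assms unfolding dirichlet_character_def by blast
  have "chi (a ^ totient D) = chi 1"
    using euler_theorem[OF True] character_mod[OF assms] unfolding cong_def by metis
  hence "cmod (chi a) ^ totient D = 1"
    using character_power[OF assms] character_one[OF assms] by (metis norm_one norm_power)
  thus ?thesis
    using D one_less_power[of "cmod (chi a)" "totient D"] by (cases "cmod (chi a) > 1") auto
next
  case False
  thus ?thesis using assms unfolding dirichlet_character_def by auto
qed

text \<open>
  Modulo 1 and modulo 2 there is only one reduced residue class, so the only character is the
  principal one.  This gives the numerical lower bound for \<open>U\<close>.
\<close>

lemma nonprincipal_modulus_ge_3:
  assumes chi: "dirichlet_character D chi" and "\<not> principal_character D chi"
  shows "D \<ge> 3"
proof (rule ccontr)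
  assume "\<not> D \<ge> 3"
  moreover have "D > 0" using chi unfolding dirichlet_character_def by blast
  ultimately have D: "D = 1 \<or> D = 2" by linarith
  have "chi a = 1" if "coprime a D" for a
  proof -
    have "a mod D = 1 mod D"
      using D that by (auto simp: odd_iff_mod_2_eq_one)
    thus ?thesis using character_mod[OF chi] character_one[OF chi] by metis
  qed
  with assms show False
    unfolding principal_character_def dirichlet_character_def by metis
qed

text \<open>
  Orthogonality: multiplication by some \<open>a\<close> coprime to \<open>D\<close> with \<open>chi a \<noteq> 1\<close> permutes the residues and
  multiplies the sum by \<open>chi a\<close>.  Periodicity then moves the starting point.
\<close>

lemma nonprincipal_sum_period_eq_0:
  assumes chi: "dirichlet_character D chi" and np: "\<not> principal_character D chi"
  shows "(\<Sum>i<D. chi (n + i)) = 0"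
proof (induction n)
  case 0
  have D: "D > 0" using chi unfolding dirichlet_character_def by blast
  obtain a where a: "coprime a D" "chi a \<noteq> 1"
    using assms unfolding principal_character_def dirichlet_character_def by metis
  have "inj_on (\<lambda>m. a * m mod D) {..<D}"
  proof (rule inj_onI)
    fix x y assume "x \<in> {..<D}" "y \<in> {..<D}" "a * x mod D = a * y mod D"
    thus "x = y"
      using cong_mult_lcancel_nat[OF a(1)] unfolding cong_def by auto
  qed
  moreover have "(\<lambda>m. a * m mod D) ` {..<D} \<subseteq> {..<D}" using D by auto
  ultimately have "bij_betw (\<lambda>m. a * m mod D) {..<D} {..<D}"
    by (metis bij_betw_def endo_inj_surj finite_lessThan)
  from sum.reindex_bij_betw[OF this, of chi]
  have "(\<Sum>m<D. chi (a * m)) = (\<Sum>m<D. chi m)"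
    using character_mod[OF chi] by simp
  hence "chi a * (\<Sum>m<D. chi m) = (\<Sum>m<D. chi m)"
    using chi unfolding dirichlet_character_def by (simp add: sum_distrib_left)
  thus ?case using a(2) by simp
next
  case (Suc n)
  have "(\<Sum>i<D. chi (n + i)) + chi (n + D) = chi n + (\<Sum>i<D. chi (Suc n + i))"
    using sum.lessThan_Suc_shift[of "\<lambda>i. chi (n + i)" D] by simp
  moreover have "chi (n + D) = chi n"
    using chi unfolding dirichlet_character_def by blast
  ultimately show ?case using Suc by simp
qed

text \<open>
  After removing full periods, an interval has \<open>N < D\<close> elements; it and its complement in a period have
  opposite sums, so the sum is at most \<open>min N (D - N)\<close>, hence at most \<open>D / 2\<close>.  The factor
  \<open>1 / 2\<close> over the bound \<open>D\<close> is what later allows an explicit constant 1.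
\<close>

lemma norm_character_interval_sum_le:
  assumes chi: "dirichlet_character D chi" and np: "\<not> principal_character D chi"
  shows "cmod (\<Sum>i<N. chi (n + i)) \<le> real (min N (D div 2))"
proof -
  have trivial_bound: "cmod (\<Sum>i\<in>A. chi (m + i)) \<le> real (card A)" for m A
    using sum_norm_bound[of A "\<lambda>i. chi (m + i)" 1] norm_character_le_1[OF chi] by simp
  have "cmod (\<Sum>i<N. chi (n + i)) \<le> real (D div 2)"
  proof (induction N arbitrary: n rule: less_induct)
    case (less N)
    show ?case
    proof (cases "N < D")
      case True
      have "(\<Sum>i<N. chi (n + i)) + (\<Sum>i\<in>{N..<D}. chi (n + i)) = 0"
        using nonprincipal_sum_period_eq_0[OF assms, of n] True
        by (subst sum.union_disjoint[symmetric]) (auto simp: ivl_disj_un)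
      hence "cmod (\<Sum>i<N. chi (n + i)) = cmod (\<Sum>i\<in>{N..<D}. chi (n + i))"
        by (metis add_eq_0_iff norm_minus_cancel)
      hence "cmod (\<Sum>i<N. chi (n + i)) \<le> real (min N (D - N))"
        using trivial_bound[of n "{N..<D}"] trivial_bound[of n "{..<N}"] by simp
      also have "\<dots> \<le> real (D div 2)"
        unfolding of_nat_le_iff by linarith
      finally show ?thesis .
    next
      case False
      have D: "D > 0" using chi unfolding dirichlet_character_def by blast
      have "(\<Sum>i<D + m. chi (n + i)) = (\<Sum>i<D. chi (n + i)) + (\<Sum>i<m. chi (n + D + i))" for m
        by (induction m) (simp_all add: add_ac)
      from this[of "N - D"]
      have "(\<Sum>i<N. chi (n + i)) = (\<Sum>i<N - D. chi (n + D + i))"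
        using False nonprincipal_sum_period_eq_0[OF assms, of n] by simp
      thus ?thesis using less[of "N - D" "n + D"] False D by simp
    qed
  qed
  thus ?thesis using trivial_bound[of n "{..<N}"] by simp
qed

section \<open>Sums with decreasing weights\<close>

text \<open>
  Abel summation in its sharpest elementary form: among sequences whose sum of the
  first \<open>n\<close> terms is at most \<open>min n M\<close> in size for all \<open>n\<close>, the extremal one is
  \<open>1\<close> for the first \<open>M\<close> terms and \<open>0\<close> afterwards.
\<close>

lemma abel_partial_sum_bound:
  fixes a h :: "nat \<Rightarrow> real"
  assumes T: "\<And>n. \<bar>\<Sum>i<n. a i\<bar> \<le> real (min n M)"
    and anti: "\<And>n. h (Suc n) \<le> h n" and nonneg: "\<And>n. h n \<ge> 0"
  shows "\<bar>\<Sum>i<N. a i * h i\<bar> \<le> (\<Sum>i<M. h i)"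
proof -
  define T where "T = (\<lambda>n. \<Sum>i<n. a i)"
  \<comment> \<open>Both sides are the result of summation by parts, for \<open>a\<close> and for the extremal sequence.\<close>
  have *: "\<bar>(\<Sum>i<N. a i * h i) - T N * h N\<bar>
          \<le> (\<Sum>i<min N M. h i) - real (min N M) * h N" for N
  proof (induction N)
    case 0
    show ?case by (simp add: T_def)
  next
    case (Suc N)
    have "(\<Sum>i<Suc N. a i * h i) - T (Suc N) * h (Suc N)
        = ((\<Sum>i<N. a i * h i) - T N * h N) + T (Suc N) * (h N - h (Suc N))"
      by (simp add: T_def algebra_simps)
    moreover have "\<bar>T (Suc N) * (h N - h (Suc N))\<bar> \<le> real (min (Suc N) M) * (h N - h (Suc N))"
      using T[of "Suc N"] anti[of N] by (simp add: T_def abs_mult mult_right_mono)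
    moreover have "(\<Sum>i<min (Suc N) M. h i) - real (min (Suc N) M) * h (Suc N)
        = ((\<Sum>i<min N M. h i) - real (min N M) * h N) + real (min (Suc N) M) * (h N - h (Suc N))"
    proof (cases "N < M")
      case True
      hence "min (Suc N) M = Suc N" "min N M = N" by auto
      thus ?thesis by (simp add: algebra_simps)
    next
      case False
      hence "min (Suc N) M = M" "min N M = M" by auto
      thus ?thesis by (simp add: algebra_simps)
    qed
    ultimately show ?case using Suc by linarith
  qed
  have "\<bar>T N * h N\<bar> \<le> real (min N M) * h N"
    using T[of N] nonneg[of N] by (simp add: T_def abs_mult mult_right_mono)
  with *[of N] have "\<bar>\<Sum>i<N. a i * h i\<bar> \<le> (\<Sum>i<min N M. h i)" by linarith
  also have "\<dots> \<le> (\<Sum>i<M. h i)" by (rule sum_mono2) (auto simp: nonneg)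
  finally show ?thesis .
qed

section \<open>The L-series to the right of the imaginary axis\<close>

text \<open>
  The mean value inequality for \<open>w \<mapsto> w powr (- z)\<close> on the segment from \<open>m\<close> to \<open>m + 1\<close>, where
  the derivative is largest at \<open>m\<close>.
\<close>

lemma norm_powr_diff_Suc_le:
  assumes z: "Re z > 0" and m: "m > 0"
  shows "cmod (of_nat m powr (- z) - of_nat (Suc m) powr (- z)) \<le> cmod z * real m powr (- Re z - 1)"
proof -
  let ?S = "closed_segment (complex_of_real (real m)) (complex_of_real (real (Suc m)))"
  have S: "w \<in> \<real> \<and> Re w \<ge> real m" if "w \<in> ?S" for w
    using that by (auto simp: closed_segment_of_real closed_segment_eq_real_ivl simp del: of_real_of_nat_eq of_nat_Suc)
  have "cmod (of_real (real m) powr (- z) - of_real (real (Suc m)) powr (- z))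
      \<le> (cmod z * real m powr (- Re z - 1)) * cmod (complex_of_real (real m) - complex_of_real (real (Suc m)))"
  proof (rule field_differentiable_bound[where S = ?S and f' = "\<lambda>w. - z * w powr (- z - 1)"])
    fix w assume w: "w \<in> ?S"
    have "w \<notin> \<real>\<^sub>\<le>\<^sub>0" using S[OF w] m by (auto simp: complex_nonpos_Reals_iff)
    thus "((\<lambda>w. w powr (- z)) has_field_derivative - z * w powr (- z - 1)) (at w within ?S)"
      by (intro has_field_derivative_at_within[OF has_field_derivative_powr])
    have "cmod (w powr (- z - 1)) = Re w powr (- Re z - 1)"
      using S[OF w] by (subst norm_powr_real_powr) auto
    also have "\<dots> \<le> real m powr (- Re z - 1)"
      using S[OF w] m z by (intro powr_mono2') auto
    finally show "cmod (- z * w powr (- z - 1)) \<le> cmod z * real m powr (- Re z - 1)"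
      by (simp add: norm_mult mult_left_mono)
  qed auto
  thus ?thesis by (simp add: norm_minus_commute)
qed

text \<open>
  Since the character sums are bounded, summation by parts turns the Dirichlet series into
  \<open>\<Sum>n. T (n + 1) * ((n + 1) powr (- z) - (n + 2) powr (- z))\<close>, whose terms are
  \<open>O(D * \<bar>z\<bar> * n powr (- Re z - 1))\<close>; this converges locally uniformly for \<open>Re z > 0\<close>.
\<close>

lemma nonprincipal_series_holomorphic:
  assumes chi: "dirichlet_character D chi" and np: "\<not> principal_character D chi"
  shows "\<exists>F. F holomorphic_on {z. Re z > 0} \<and>
    (\<forall>z. Re z > 0 \<longrightarrow> (\<lambda>m. chi m * of_nat m powr (- z)) sums F z)"
proof -
  define T where "T n = (\<Sum>i<n. chi (1 + i))" for n
  define u where "u n z = (of_nat (Suc n) :: complex) powr (- z)" for n z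
  define F where "F z = (\<Sum>n. T (Suc n) * (u n z - u (Suc n) z))" for z
  have T: "cmod (T n) \<le> real D" for n
  proof -
    have "real (min n (D div 2)) \<le> real D" unfolding of_nat_le_iff by linarith
    thus ?thesis using norm_character_interval_sum_le[OF assms, of 1 n] unfolding T_def by linarith
  qed
  have ul: "uniform_limit (cball x (Re x / 2)) (\<lambda>N z. \<Sum>n<N. T (Suc n) * (u n z - u (Suc n) z)) F sequentially"
    if x: "Re x > 0" for x
    unfolding F_def
  proof (rule Weierstrass_m_test)
    let ?d = "Re x / 2"
    let ?M = "\<lambda>n. real D * (cmod x + ?d) * real (Suc n) powr (- ?d - 1)"
    have "summable (\<lambda>n. real n powr (- ?d - 1))"
      using x by (subst summable_real_powr_iff) auto
    thus "summable ?M" by (intro summable_mult) (subst summable_Suc_iff)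
    fix n z assume "z \<in> cball x ?d"
    hence zx: "cmod (z - x) \<le> ?d" by (simp add: dist_norm norm_minus_commute)
    have Re: "Re z \<ge> ?d" using zx abs_Re_le_cmod[of "z - x"] by simp
    have nz: "cmod z \<le> cmod x + ?d" using zx norm_triangle_sub[of z x] by linarith
    have "cmod (u n z - u (Suc n) z) \<le> cmod z * real (Suc n) powr (- Re z - 1)"
      unfolding u_def using Re x by (intro norm_powr_diff_Suc_le) auto
    also have "\<dots> \<le> (cmod x + ?d) * real (Suc n) powr (- ?d - 1)"
      using nz Re x by (intro mult_mono powr_mono) auto
    finally show "cmod (T (Suc n) * (u n z - u (Suc n) z)) \<le> ?M n"
      using T[of "Suc n"] by (simp add: norm_mult mult.assoc mult_mono del: of_nat_Suc)
  qed
  have "F holomorphic_on {z. Re z > 0}"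
  proof (rule holomorphic_uniform_sequence[where f = "\<lambda>N z. \<Sum>n<N. T (Suc n) * (u n z - u (Suc n) z)"])
    show "(\<lambda>z. \<Sum>n<N. T (Suc n) * (u n z - u (Suc n) z)) holomorphic_on {z. Re z > 0}" for N
      unfolding u_def by (intro holomorphic_intros)
    fix x :: complex assume "x \<in> {z. Re z > 0}"
    hence x: "Re x > 0" by simp
    have "cball x (Re x / 2) \<subseteq> {z. Re z > 0}"
    proof
      fix z assume "z \<in> cball x (Re x / 2)"
      hence "cmod (z - x) \<le> Re x / 2" by (simp add: dist_norm norm_minus_commute)
      thus "z \<in> {z. Re z > 0}" using abs_Re_le_cmod[of "z - x"] x by simp
    qed
    thus "\<exists>d>0. cball x d \<subseteq> {z. Re z > 0} \<and>
        uniform_limit (cball x d) (\<lambda>N z. \<Sum>n<N. T (Suc n) * (u n z - u (Suc n) z)) F sequentially"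
      using ul[OF x] x by (intro exI[of _ "Re x / 2"]) auto
  qed (rule open_halfspace_Re_gt)
  moreover have "(\<lambda>m. chi m * of_nat m powr (- z)) sums F z" if z: "Re z > 0" for z
  proof -
    have parts: "(\<Sum>n<N. chi (Suc n) * u n z) = (\<Sum>n<N. T (Suc n) * (u n z - u (Suc n) z)) + T N * u N z" for N
      by (induction N) (simp_all add: T_def algebra_simps)
    have "(\<lambda>N. \<Sum>n<N. T (Suc n) * (u n z - u (Suc n) z)) \<longlonglongrightarrow> F z"
      using tendsto_uniform_limitI[OF ul[OF z], of z] z by simp
    moreover have "(\<lambda>N. T N * u N z) \<longlonglongrightarrow> 0"
    proof (rule Lim_null_comparison)
      have "cmod (T N * u N z) \<le> real D * real (Suc N) powr (- Re z)" for N
        using T[of N] by (simp add: u_def norm_mult norm_powr_real_powr mult_right_mono)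
      thus "\<forall>\<^sub>F N in sequentially. cmod (T N * u N z) \<le> real D * real (Suc N) powr (- Re z)"
        by simp
      show "(\<lambda>N. real D * real (Suc N) powr (- Re z)) \<longlonglongrightarrow> 0"
        using z by real_asymp
    qed
    ultimately have "(\<lambda>N. \<Sum>n<N. chi (Suc n) * u n z) \<longlonglongrightarrow> F z + 0"
      unfolding parts by (rule tendsto_add)
    hence "(\<lambda>n. chi (Suc n) * of_nat (Suc n) powr (- z)) sums F z"
      unfolding sums_def u_def by simp
    thus ?thesis
      using sums_Suc_iff[of "\<lambda>m. chi m * of_nat m powr (- z)"] by simp
  qed
  ultimately show ?thesis by blast
qed

text \<open>
  The sum of the series is a continuation of the required kind to \<open>Re z > 0\<close>, and by the identity theorem any
  other one agrees with it on the common half-plane.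
\<close>

lemma dirichlet_L_sums:
  assumes chi: "dirichlet_character D chi" and np: "\<not> principal_character D chi" and s: "Re s > 0"
  shows "(\<lambda>m. chi m * of_nat m powr (- s)) sums dirichlet_L D chi s"
proof -
  obtain F where F: "F holomorphic_on {z. Re z > 0}"
    and Fs: "\<And>z. Re z > 0 \<Longrightarrow> (\<lambda>m. chi m * of_nat m powr (- z)) sums F z"
    using nonprincipal_series_holomorphic[OF assms(1,2)] by blast
  have "dirichlet_L D chi s = F s"
    unfolding dirichlet_L_def
  proof (rule the_equality)
    show "\<exists>f c. c < Re s \<and>
        f holomorphic_on ({z. Re z > c} - (if principal_character D chi then {1} else {})) \<and>
        (\<forall>z. Re z > 1 \<longrightarrow> (\<lambda>m. chi m * of_nat m powr (- z)) sums f z) \<and> F s = f s"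
      using F Fs np s by (intro exI[of _ F] exI[of _ 0]) auto
  next
    fix w
    assume "\<exists>f c. c < Re s \<and>
        f holomorphic_on ({z. Re z > c} - (if principal_character D chi then {1} else {})) \<and>
        (\<forall>z. Re z > 1 \<longrightarrow> (\<lambda>m. chi m * of_nat m powr (- z)) sums f z) \<and> w = f s"
    then obtain f c where c: "c < Re s" and f: "f holomorphic_on {z. Re z > c}"
      and fs: "\<And>z. Re z > 1 \<Longrightarrow> (\<lambda>m. chi m * of_nat m powr (- z)) sums f z" and w: "w = f s"
      using np by auto
    have "f s = F s"
    proof (rule analytic_continuation_open[where f = f and g = F and z = s and s = "{z. Re z > max 1 c}" and s' = "{z. Re z > max 0 c}"])
      show "{z. Re z > max 1 c} \<noteq> {}"
        by (auto intro!: exI[of _ "of_real (max 1 c + 1)"])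
      show "open {z. Re z > max 1 c}" "open {z. Re z > max 0 c}"
        by (rule open_halfspace_Re_gt)+
      show "connected {z. Re z > max 0 c}"
        by (intro convex_connected convex_halfspace_Re_gt)
      show "f holomorphic_on {z. Re z > max 0 c}" "F holomorphic_on {z. Re z > max 0 c}"
        using f F by (auto intro: holomorphic_on_subset)
      show "f z = F z" if "z \<in> {z. Re z > max 1 c}" for z
        using that fs[of z] Fs[of z] by (auto intro: sums_unique2)
    qed (use c s in auto)
    with w show "w = F s" by simp
  qed
  thus ?thesis using Fs[OF s] by simp
qed

section \<open>Absence of zeros to the right of 1\<close>

text \<open>
  The sieve behind the Euler product.  Restricting the sum from the integers free of the primes below \<open>p\<close> to
  those also free of \<open>p\<close> multiplies it by \<open>1 - f p\<close>.  If the full sum vanished, so would all the sifted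
  sums; but the sum over the integers free of primes up to \<open>N\<close> consists of \<open>f 1 = 1\<close> and terms
  with \<open>n > N\<close>, so it tends to \<open>1\<close>.
\<close>

lemma completely_multiplicative_suminf_nonzero:
  fixes f :: "nat \<Rightarrow> 'a :: {real_normed_field, banach}"
  assumes mult: "\<And>a b. f (a * b) = f a * f b" and one: "f 1 = 1"
    and summ: "summable (\<lambda>n. norm (f n))" and "f 0 = 0"
  shows "suminf f \<noteq> 0"
proof
  assume zero: "suminf f = 0"
  define A where "A N = {n. n > 0 \<and> (\<forall>p. prime p \<longrightarrow> p \<le> N \<longrightarrow> \<not> p dvd n)}" for N :: nat
  have so: "f summable_on X" for X
    using norm_summable_imp_summable_on[OF summ] by (rule summable_on_subset_banach) simp
  have sieve: "infsum f (A N) = 0" for N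
  proof (induction N)
    case 0
    have "A 0 = UNIV - {0}" by (auto simp: A_def)
    hence "infsum f (A 0) = infsum f UNIV"
      using \<open>f 0 = 0\<close> by (intro infsum_cong_neutral) auto
    also have "\<dots> = suminf f"
      using norm_summable_imp_has_sum[OF summ summable_sums[OF summable_norm_cancel[OF summ]]]
      by (rule infsumI)
    finally show ?case using zero by simp
  next
    case (Suc N)
    show ?case
    proof (cases "prime (Suc N)")
      case False
      hence "A (Suc N) = A N" unfolding A_def by (metis le_Suc_eq)
      thus ?thesis using Suc by simp
    next
      case True
      let ?p = "Suc N"
      have coprime_p: "\<not> q dvd ?p" if "prime q" "q \<le> N" for q
        using that primes_dvd_imp_eq[OF that(1) True] by auto
      have split: "A N = A ?p \<union> (\<lambda>n. ?p * n) ` A N"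
      proof (intro equalityI subsetI)
        fix n assume n: "n \<in> A N"
        show "n \<in> A ?p \<union> (\<lambda>n. ?p * n) ` A N"
        proof (cases "?p dvd n")
          case True
          then obtain m where m: "n = ?p * m" by blast
          have "m > 0" using n m by (cases m) (auto simp: A_def)
          hence "m \<in> A N" using n dvd_mult[of _ m ?p] unfolding A_def m by blast
          thus ?thesis using m by blast
        next
          case False
          hence "n \<in> A ?p" using n unfolding A_def by (auto simp: le_Suc_eq)
          thus ?thesis by blast
        qed
      next
        fix n assume "n \<in> A ?p \<union> (\<lambda>n. ?p * n) ` A N"
        thus "n \<in> A N"
          using coprime_p by (auto simp: A_def prime_dvd_mult_iff simp del: mult_Suc)
      qed
      have "infsum f (A N) = infsum f (A ?p) + infsum f ((\<lambda>n. ?p * n) ` A N)"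
        by (subst split, rule infsum_Un_disjoint) (use so True in \<open>auto simp: A_def simp del: mult_Suc\<close>)
      also have "infsum f ((\<lambda>n. ?p * n) ` A N) = f ?p * infsum f (A N)"
        by (subst infsum_reindex) (auto simp: inj_on_def o_def mult infsum_cmult_right' simp del: mult_Suc)
      finally show ?thesis using Suc by simp
    qed
  qed
  \<comment> \<open>An integer \<open>n > 1\<close> free of primes up to \<open>N\<close> exceeds \<open>N\<close>, so the tail must cancel the term \<open>f 1\<close>.\<close>
  have tail: "1 \<le> suminf (\<lambda>n. norm (f (n + Suc N)))" for N
  proof -
    have sub: "A N - {1} \<subseteq> {Suc N..}"
    proof
      fix n assume n: "n \<in> A N - {1}"
      then obtain p where p: "prime p" "p dvd n" using prime_factor_nat[of n] by auto
      with n have "p > N" "n > 0" by (auto simp: A_def not_le)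
      with p dvd_imp_le[of p n] show "n \<in> {Suc N..}" by simp
    qed
    have "infsum f (A N) = infsum f {1} + infsum f (A N - {1})"
    proof (subst infsum_Un_disjoint[symmetric])
      have "1 \<in> A N" by (auto simp: A_def)
      thus "infsum f (A N) = infsum f ({1} \<union> (A N - {1}))" by (simp add: insert_absorb)
    qed (use so in auto)
    hence "infsum f (A N - {1}) + 1 = 0"
      using sieve[of N] one by (simp add: add.commute)
    hence "infsum f (A N - {1}) = - 1"
      by (rule eq_neg_iff_add_eq_0[THEN iffD2])
    hence "1 = norm (infsum f (A N - {1}))" by simp
    also have "\<dots> \<le> infsum (\<lambda>n. norm (f n)) (A N - {1})"
      by (rule norm_infsum_bound)
         (use norm_summable_imp_summable_on[of "\<lambda>n. norm (f n)"] summ in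
           \<open>auto intro: summable_on_subset\<close>)
    also have "\<dots> \<le> infsum (\<lambda>n. norm (f n)) {Suc N..}"
      using sub by (intro infsum_mono_neutral)
         (use norm_summable_imp_summable_on[of "\<lambda>n. norm (f n)"] summ in
           \<open>auto intro: summable_on_subset\<close>)
    also have "{Suc N..} = (\<lambda>n. n + Suc N) ` UNIV"
      by (auto simp: image_iff) presburger
    also have "infsum (\<lambda>n. norm (f n)) \<dots> = infsum (\<lambda>n. norm (f (n + Suc N))) UNIV"
      by (subst infsum_reindex) (auto simp: o_def inj_on_def)
    also have "\<dots> = suminf (\<lambda>n. norm (f (n + Suc N)))"
      using summable_ignore_initial_segment[OF summ, of "Suc N"]
      by (intro infsumI norm_summable_imp_has_sum summable_sums) auto
    finally show ?thesis .
  qed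
  have "(\<lambda>N. suminf (\<lambda>n. norm (f (n + N)))) \<longlonglongrightarrow> 0"
    using suminf_exist_split2[OF summ] .
  hence "(\<lambda>N. suminf (\<lambda>n. norm (f (n + Suc N)))) \<longlonglongrightarrow> 0"
    by (rule LIMSEQ_Suc)
  from LIMSEQ_le_const[OF this, of 1] tail show False by simp
qed

lemma dirichlet_L_nonzero_right_of_1:
  assumes chi: "dirichlet_character D chi" and np: "\<not> principal_character D chi" and s: "Re s > 1"
  shows "dirichlet_L D chi s \<noteq> 0"
proof -
  let ?f = "\<lambda>m. chi m * of_nat m powr (- s)"
  have "?f (a * b) = ?f a * ?f b" for a b
    using chi unfolding dirichlet_character_def by (simp add: powr_times_real)
  moreover have "summable (\<lambda>m. cmod (?f m))"
  proof (rule summable_comparison_test')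
    show "summable (\<lambda>m. real m powr (- Re s))"
      using s by (simp add: summable_real_powr_iff)
    show "norm (cmod (?f m)) \<le> real m powr (- Re s)" for m
      using norm_character_le_1[OF chi, of m]
      by (simp add: norm_mult norm_powr_real_powr mult_left_le_one_le)
  qed
  ultimately have "suminf ?f \<noteq> 0"
    using character_one[OF chi] by (intro completely_multiplicative_suminf_nonzero) auto
  thus ?thesis using sums_unique[OF dirichlet_L_sums[OF chi np, of s]] s by simp
qed

section \<open>The value at 1 and a real zero near 1\<close>

text \<open>
  The weight \<open>h\<close> has to decrease only from \<open>m\<close> on: the first \<open>m\<close> terms are estimated trivially and the rest
  by Abel summation over the interval sums of the character starting at \<open>m\<close>.
\<close>

lemma character_series_bound:
  assumes chi: "dirichlet_character D chi" and np: "\<not> principal_character D chi"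
    and nonneg: "\<And>n. h n \<ge> (0::real)" and anti: "\<And>n. n \<ge> m \<Longrightarrow> h (Suc n) \<le> h n"
    and sums: "(\<lambda>n. Re (chi n) * h n) sums s"
  shows "\<bar>s\<bar> \<le> (\<Sum>n<m + D div 2. h n)"
proof -
  have split: "(\<Sum>n<m + N. f n) = (\<Sum>n<m. f n) + (\<Sum>i<N. f (m + i))" for f :: "nat \<Rightarrow> real" and N
    by (induction N) simp_all
  have "\<bar>\<Sum>n<m + N. Re (chi n) * h n\<bar> \<le> (\<Sum>n<m + D div 2. h n)" for N
  proof -
    have "\<bar>Re (chi n) * h n\<bar> \<le> h n" for n
      using norm_character_le_1[OF chi, of n] abs_Re_le_cmod[of "chi n"] nonneg[of n]
      by (simp add: abs_mult mult_left_le_one_le)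
    hence "\<bar>\<Sum>n<m. Re (chi n) * h n\<bar> \<le> (\<Sum>n<m. h n)"
      by (intro order_trans[OF sum_abs] sum_mono)
    moreover have "\<bar>\<Sum>i<n. Re (chi (m + i))\<bar> \<le> real (min n (D div 2))" for n
      using norm_character_interval_sum_le[OF chi np, of m n]
        abs_Re_le_cmod[of "\<Sum>i<n. chi (m + i)"] by simp
    hence "\<bar>\<Sum>i<N. Re (chi (m + i)) * h (m + i)\<bar> \<le> (\<Sum>i<D div 2. h (m + i))"
      using anti nonneg by (intro abel_partial_sum_bound) auto
    ultimately show ?thesis unfolding split by linarith
  qed
  moreover have "(\<lambda>N. \<bar>\<Sum>n<m + N. Re (chi n) * h n\<bar>) \<longlonglongrightarrow> \<bar>s\<bar>"
    using LIMSEQ_ignore_initial_segment[OF sums[unfolded sums_def], of m]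
    by (intro tendsto_rabs) (simp add: add.commute)
  ultimately show ?thesis
    by (intro LIMSEQ_le_const2) auto
qed

lemma Re_dirichlet_L_sums:
  assumes "dirichlet_character D chi" and "\<not> principal_character D chi" and "x > 0"
  shows "(\<lambda>n. Re (chi n) * real n powr (- x)) sums Re (dirichlet_L D chi (of_real x))"
proof -
  have "Re (chi n * of_nat n powr (- of_real x)) = Re (chi n) * real n powr (- x)" for n
    using powr_of_real[of "real n" "- x"] by simp
  thus ?thesis
    using sums_Re[OF dirichlet_L_sums[OF assms(1,2), of "of_real x"]] assms(3) by simp
qed

text \<open>
  The bound used for zeros that are not close to 1: the sum of \<open>1 / n\<close> over \<open>n \<le> D div 2\<close>.
\<close>

lemma dirichlet_L_1_le_ln:
  assumes chi: "dirichlet_character D chi" and np: "\<not> principal_character D chi"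
  shows "\<bar>Re (dirichlet_L D chi 1)\<bar> \<le> 1 + ln (real (D div 2))"
proof -
  have D: "D div 2 > 0" using nonprincipal_modulus_ge_3[OF assms] by linarith
  have "(\<lambda>n. Re (chi n) * (1 / real n)) sums Re (dirichlet_L D chi 1)"
    using Re_dirichlet_L_sums[OF assms, of 1] by (simp add: powr_minus_divide)
  hence "\<bar>Re (dirichlet_L D chi 1)\<bar> \<le> (\<Sum>n<1 + D div 2. 1 / real n)"
    by (intro character_series_bound[OF assms]) (auto simp: frac_le)
  also have "\<dots> = (harm (D div 2) :: real)"
    unfolding harm_def by (rule sum.mono_neutral_cong_right) (auto simp: field_simps)
  also have "\<dots> \<le> 1 + ln (real (D div 2))"
    using euler_mascheroni_sequence_decreasing[of 1 "D div 2"] D by (simp add: harm_def)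
  finally show ?thesis .
qed

text \<open>
  The function \<open>4 powr (- d)\<close> is convex, and \<open>1 - d\<close> is its chord between \<open>d = 0\<close> and \<open>d = 1 / 2\<close>.
\<close>

lemma four_powr_bound:
  fixes d :: real
  assumes "0 \<le> d" "d \<le> 1 / 2"
  shows "1 \<le> (1 - d) * 4 powr d"
proof -
  have "exp ((1 - 2 * d) *\<^sub>R 0 + (2 * d) *\<^sub>R (- ln 2)) \<le> (1 - 2 * d) * exp 0 + (2 * d) * exp (- ln 2 :: real)"
    using assms by (intro convex_onD[OF exp_convex]) auto
  also have "exp ((1 - 2 * d) *\<^sub>R 0 + (2 * d) *\<^sub>R (- ln 2)) = 1 / (4 powr d :: real)"
    using ln_realpow[of 2 2] by (simp add: powr_def exp_minus field_simps)
  also have "(1 - 2 * d) * exp 0 + (2 * d) * exp (- ln 2 :: real) = 1 - d"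
    by (simp add: exp_minus)
  finally show ?thesis by (simp add: field_simps)
qed

text \<open>
  The derivative is \<open>(1 - (1 - d) * x powr d) / x\<^sup>2\<close>.  For \<open>d \<le> 1 / 2\<close> it is nonpositive from
  \<open>x = 4\<close> on, and at \<open>d = 1 / 2\<close> no earlier start would do.
\<close>

lemma powr_minus_1_over_antimono:
  fixes d x y :: real
  assumes d: "0 \<le> d" "d \<le> 1 / 2" and xy: "4 \<le> x" "x \<le> y"
  shows "(y powr d - 1) / y \<le> (x powr d - 1) / x"
proof (rule DERIV_nonpos_imp_nonincreasing[OF xy(2)])
  fix z assume "x \<le> z"
  hence z: "z \<ge> 4" using xy by simp
  have "((\<lambda>z. (z powr d - 1) / z) has_real_derivative (1 - (1 - d) * z powr d) / z\<^sup>2) (at z)"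
    using z by (auto intro!: derivative_eq_intros simp: powr_diff field_simps power2_eq_square)
  moreover have "4 powr d \<le> z powr d" using z d by (intro powr_mono2) auto
  hence "(1 - d) * 4 powr d \<le> (1 - d) * z powr d" using d by (intro mult_left_mono) auto
  hence "(1 - (1 - d) * z powr d) / z\<^sup>2 \<le> 0"
    using four_powr_bound[OF d] by (intro divide_nonpos_nonneg) auto
  ultimately show "\<exists>l. ((\<lambda>z. (z powr d - 1) / z) has_real_derivative l) (at z) \<and> l \<le> 0"
    by blast
qed

text \<open>
  Subtracting the vanishing series at \<open>1 - d\<close> from the series at \<open>1\<close> leaves the weights
  \<open>1 / n - n powr (d - 1) = - (n powr d - 1) / n\<close>, which are of size \<open>d * ln n / n\<close>.  This
  replaces the mean value theorem for \<open>L\<close> and a bound of its derivative.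
\<close>

lemma dirichlet_L_1_le_of_zero:
  assumes chi: "dirichlet_character D chi" and np: "\<not> principal_character D chi"
    and d: "0 < d" "d \<le> 1 / 2" and zero: "dirichlet_L D chi (of_real (1 - d)) = 0"
  shows "\<bar>Re (dirichlet_L D chi 1)\<bar> \<le> (\<Sum>n<4 + D div 2. (real n powr d - 1) / real n)"
proof -
  let ?g = "\<lambda>n. (real n powr d - 1) / real n"
  have "(\<lambda>n. Re (chi n) * real n powr (- (1 - d)) - Re (chi n) * real n powr (- 1))
      sums (Re (dirichlet_L D chi (of_real (1 - d))) - Re (dirichlet_L D chi (of_real 1)))"
    using d by (intro sums_diff Re_dirichlet_L_sums[OF chi np]) auto
  moreover have "real n powr (- (1 - d)) - real n powr (- 1) = ?g n" for n
    by (cases "n = 0") (simp_all add: powr_diff powr_minus_divide diff_divide_distrib)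
  hence "Re (chi n) * real n powr (- (1 - d)) - Re (chi n) * real n powr (- 1) = Re (chi n) * ?g n" for n
    by (metis right_diff_distrib)
  ultimately have "(\<lambda>n. Re (chi n) * ?g n) sums (- Re (dirichlet_L D chi 1))"
    using zero by simp
  moreover have "?g n \<ge> 0" for n
    using d by (cases "n = 0") (auto simp: ge_one_powr_ge_zero)
  moreover have "?g (Suc n) \<le> ?g n" if "n \<ge> 4" for n
    using d that by (intro powr_minus_1_over_antimono) auto
  ultimately have "\<bar>- Re (dirichlet_L D chi 1)\<bar> \<le> (\<Sum>n<4 + D div 2. ?g n)"
    by (intro character_series_bound[OF chi np])
  thus ?thesis by simp
qed

text \<open>
  Comparison with the integral of \<open>ln x / x\<close>, which decreases from \<open>x = e\<close> on; hence the start at \<open>N = 3\<close>.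
  The factor \<open>1 / 2\<close> in the main term leaves room for the factor \<open>2\<close> in \<open>exp x - 1 \<le> 2 * x\<close> below.
\<close>

lemma sum_ln_over_le:
  assumes "N \<ge> 3"
  shows "(\<Sum>n<Suc N. ln (real n) / real n) \<le> (ln (real N))\<^sup>2 / 2 + 1 / 5"
  using assms
proof (induction N rule: dec_induct)
  case base
  have "(ln 3 - 1) * (ln 3 / 2 + 1 / 6) = (ln 3)\<^sup>2 / 2 - ln 3 / 3 - (1 / 6 :: real)"
    by (simp add: field_simps power2_eq_square)
  moreover have "0 \<le> (ln 3 - 1) * (ln 3 / 2 + 1 / 6 :: real)" using ln3_gt_1 by simp
  ultimately have "ln 3 / 3 \<le> (ln 3)\<^sup>2 / 2 - (1 / 6 :: real)"
    by linarith
  moreover have "(\<Sum>n<Suc 3. ln (real n) / real n) = ln 2 / 2 + ln 3 / 3"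
    by (simp add: numeral_3_eq_3)
  ultimately show ?case using ln2_le_25_over_36 by simp
next
  case (step n)
  let ?F = "\<lambda>x::real. (ln x)\<^sup>2 / 2"
  have "\<exists>z>real n. z < real (Suc n) \<and> ?F (real (Suc n)) - ?F (real n) = (real (Suc n) - real n) * (ln z / z)"
    using step by (intro MVT2) (auto intro!: derivative_eq_intros)
  then obtain z where z: "z > real n" "z < real (Suc n)" "?F (real (Suc n)) - ?F (real n) = ln z / z"
    by auto
  have "exp 1 \<le> z" using exp_le step z by linarith
  hence "ln (real (Suc n)) / real (Suc n) \<le> ln z / z" using z by (intro ln_x_over_x_mono) auto
  thus ?case using step.IH z(3) by simp
qed

lemma exp_minus_1_le:
  fixes x :: real assumes "0 \<le> x" "x \<le> 1" shows "exp x - 1 \<le> 2 * x"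
proof -
  have "x\<^sup>2 \<le> x" using assms by (simp add: power2_eq_square mult_left_le_one_le)
  with exp_bound[OF assms] show ?thesis by linarith
qed

text \<open>
  With \<open>y = ln U\<close>, there are two ranges.  If \<open>d * y \<ge> 1\<close> or \<open>d \<ge> 1 / 2\<close>, the bound
  \<open>1 + ln (D div 2) \<le> y - 1 / 2\<close> suffices; it is below \<open>y \<le> d * y\<^sup>2\<close> in the first case and below
  \<open>y\<^sup>2 / 2 \<le> d * y\<^sup>2\<close> in the second because \<open>(y - 1)\<^sup>2 > 0\<close>.  Otherwise every \<open>n \<le> U\<close> satisfies
  \<open>d * ln n \<le> 1\<close>, so that \<open>n powr d - 1 \<le> 2 * d * ln n\<close>, and the weights sum to at most
  \<open>d * ((ln N)\<^sup>2 + 2 / 5)\<close> with \<open>N = 3 + D div 2 \<le> 2 * U / 3\<close>.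
\<close>

lemma dirichlet_L_1_less_of_zero:
  assumes chi: "dirichlet_character D chi" and np: "\<not> principal_character D chi"
    and d: "0 < d" and zero: "dirichlet_L D chi (of_real (1 - d)) = 0" and U: "U \<ge> 9 / 4 * real D"
  shows "Re (dirichlet_L D chi 1) < d * (ln U)\<^sup>2"
proof -
  define M where "M = D div 2"
  have D: "D \<ge> 3" by (rule nonprincipal_modulus_ge_3[OF chi np])
  have M: "M > 0" "real M \<le> real D / 2" using D unfolding M_def by linarith+
  have "U > 3" using U D by linarith
  hence y: "ln U > 1" using ln3_gt_1 ln_less_cancel_iff[of 3 U] by linarith
  show ?thesis
  proof (cases "d * ln U \<ge> 1 \<or> d \<ge> 1 / 2")
    case True
    \<comment> \<open>From \<open>D div 2 \<le> 2 * U / 9\<close>, the gain over \<open>ln U\<close> is \<open>ln (9 / 2)\<close>, which barely exceeds \<open>3 / 2\<close>.\<close>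
    have "exp (3 / 2 :: real) ^ 2 = exp 1 ^ 3"
      by (simp add: exp_of_nat_mult[symmetric] exp_double[symmetric])
    also have "\<dots> \<le> (272 / 100) ^ 3" using e_less_272 by (intro power_mono) auto
    also have "\<dots> \<le> (9 / 2 :: real) ^ 2" by (simp add: power2_eq_square power3_eq_cube)
    finally have "exp (3 / 2 :: real) \<le> 9 / 2" by (rule power2_le_imp_le) simp
    hence "ln (9 / 2 :: real) \<ge> 3 / 2" by (subst ln_ge_iff) auto
    moreover have "ln (real M) + ln (9 / 2) = ln (real M * (9 / 2))"
      using M by (subst ln_mult_pos) auto
    moreover have "\<dots> \<le> ln U" using U M by (subst ln_le_cancel_iff) auto
    ultimately have "Re (dirichlet_L D chi 1) \<le> ln U - 1 / 2"
      using dirichlet_L_1_le_ln[OF chi np] unfolding M_def by linarith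
    also have "\<dots> < d * (ln U)\<^sup>2"
    proof (cases "d * ln U \<ge> 1")
      case True
      have "1 * ln U \<le> (d * ln U) * ln U" using True y by (intro mult_right_mono) auto
      thus ?thesis by (simp add: power2_eq_square)
    next
      case False
      have "0 < (ln U - 1)\<^sup>2" using y by simp
      hence "ln U - 1 / 2 < 1 / 2 * (ln U)\<^sup>2" by (simp add: power2_eq_square algebra_simps)
      also have "\<dots> \<le> d * (ln U)\<^sup>2" using False True by (intro mult_right_mono) auto
      finally show ?thesis .
    qed
    finally show ?thesis .
  next
    case False
    let ?N = "3 + M"
    \<comment> \<open>As \<open>D \<ge> 3\<close>, \<open>3 + D / 2 \<le> 3 * D / 2 \<le> 2 * U / 3\<close>.\<close>
    have N: "real ?N \<le> U / (3 / 2)" using M D U by simp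
    have "Re (dirichlet_L D chi 1) \<le> (\<Sum>n<Suc ?N. (real n powr d - 1) / real n)"
      using dirichlet_L_1_le_of_zero[OF chi np d _ zero] False unfolding M_def by simp
    also have "\<dots> \<le> (\<Sum>n<Suc ?N. 2 * d * (ln (real n) / real n))"
    proof (rule sum_mono)
      fix n assume n: "n \<in> {..<Suc ?N}"
      show "(real n powr d - 1) / real n \<le> 2 * d * (ln (real n) / real n)"
      proof (cases "n = 0")
        case False
        have "ln (real n) \<le> ln U" using n N False \<open>U > 3\<close> by (subst ln_le_cancel_iff) auto
        hence "d * ln (real n) \<le> d * ln U" using d by (intro mult_left_mono) auto
        also have "\<dots> \<le> 1" using \<open>\<not> (d * ln U \<ge> 1 \<or> d \<ge> 1 / 2)\<close> by simp
        finally have "exp (d * ln (real n)) - 1 \<le> 2 * (d * ln (real n))"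
          using d False by (intro exp_minus_1_le) auto
        thus ?thesis using False by (simp add: powr_def divide_right_mono)
      qed simp
    qed
    also have "\<dots> = 2 * d * (\<Sum>n<Suc ?N. ln (real n) / real n)"
      by (rule sum_distrib_left[symmetric])
    also have "\<dots> \<le> 2 * d * ((ln (real ?N))\<^sup>2 / 2 + 1 / 5)"
      using d by (intro mult_left_mono sum_ln_over_le) auto
    also have "\<dots> = d * ((ln (real ?N))\<^sup>2 + 2 / 5)" by (simp add: algebra_simps)
    also have "\<dots> < d * (ln U)\<^sup>2"
    proof -
      have "ln (real ?N) \<le> ln (U / (3 / 2))" using N \<open>U > 3\<close> by (subst ln_le_cancel_iff) auto
      also have "\<dots> = ln U - ln (3 / 2)" using \<open>U > 3\<close> by (subst ln_divide_pos) auto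
      finally have "ln (real ?N) + ln (3 / 2) \<le> ln U" by simp
      moreover have "ln (3 / 2) \<ge> (1 / 3 :: real)"
        using ln_le_minus_one[of "2 / 3 :: real"] ln_divide_pos[of 2 3] ln_divide_pos[of 3 2] by simp
      moreover have "ln (real ?N) \<ge> 1"
      proof -
        have "ln 3 \<le> ln (real ?N)" by (subst ln_le_cancel_iff) auto
        thus ?thesis using ln3_gt_1 by linarith
      qed
      ultimately have "(ln U - ln (real ?N)) * (ln U + ln (real ?N)) \<ge> 1 / 3 * 2"
        using y by (intro mult_mono) auto
      hence "(ln (real ?N))\<^sup>2 + 2 / 5 < (ln U)\<^sup>2" by (simp add: power2_eq_square algebra_simps)
      thus ?thesis using d by (intro mult_strict_left_mono) auto
    qed
    finally show ?thesis .
  qed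
qed

theorem theorem3:
  fixes c\<^sub>1 \<gamma> t \<delta> b U :: real
    and k D :: nat
    and chik chiD :: "nat \<Rightarrow> complex"
    and s\<^sub>0 :: complex
  assumes "L1_bound_constant c\<^sub>1"
    and "dirichlet_character k chik" and "\<not> principal_character k chik"
    and "s\<^sub>0 = Complex (1 - \<gamma>) t"
    and "dirichlet_L k chik s\<^sub>0 = 0"
    and "if real_character chik then \<gamma> < 1 / 4 else \<gamma> \<le> 1 / 8"
    and "dirichlet_character D chiD" and "real_character chiD"
    and "\<not> principal_character D chiD"
    and "\<not> principal_character (k * D) (\<lambda>a. chik a * chiD a)"
    and "greatest_real_zero (dirichlet_L D chiD) (1 - \<delta>)"
    and "U = real k * cmod s\<^sub>0 * real D"
    and "1 / (2 * (1 - 3 * \<gamma>)) < b" and "b < 1 / (2 * \<gamma>)"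
  shows "\<delta> > c\<^sub>1 / (U powr (b * \<gamma>) * ln U ^ 5)"
proof -
  have g4: "\<gamma> < 1 / 4" using assms(6) by (auto split: if_splits)
  \<comment> \<open>For \<open>\<gamma> \<le> 0\<close> the range of \<open>b\<close> is empty; the case \<open>\<gamma> = 0\<close> uses \<open>1 / 0 = 0\<close>.\<close>
  have "1 / (2 * (1 - 3 * \<gamma>)) > 0" using g4 by simp
  hence "1 / (2 * \<gamma>) > 0" using assms(13,14) by linarith
  hence g0: "\<gamma> > 0" by (simp add: zero_less_divide_iff)
  have c1: "c\<^sub>1 > 0" using assms(1) unfolding L1_bound_constant_def by blast
  have L1: "c\<^sub>1 / (U powr (b * \<gamma>) * ln U ^ 3) \<le> Re (dirichlet_L D chiD 1)"
    using assms(1) assms(2-5) g0 assms(6-10,12-14) unfolding L1_bound_constant_def by blast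
  have zero: "dirichlet_L D chiD (of_real (1 - \<delta>)) = 0"
    using assms(11) unfolding greatest_real_zero_def by blast
  have k: "k \<ge> 3" and D: "D \<ge> 3"
    using nonprincipal_modulus_ge_3 assms by blast+
  have "cmod s\<^sub>0 \<ge> 3 / 4"
    using abs_Re_le_cmod[of s\<^sub>0] assms(4) g4 by simp
  hence "3 * (3 / 4) \<le> real k * cmod s\<^sub>0" using k by (intro mult_mono) auto
  hence U: "U \<ge> 9 / 4 * real D" unfolding assms(12) by (intro mult_right_mono) auto
  hence "U > 1" using D by linarith
  hence y: "ln U > 0" by simp
  have pos: "c\<^sub>1 / (U powr (b * \<gamma>) * ln U ^ 3) > 0"
    using c1 y \<open>U > 1\<close> by simp
  \<comment> \<open>The zero is not at 1 by the lower bound for \<open>L(1)\<close>, and not beyond 1 by the Euler product.\<close>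
  have "\<delta> > 0"
  proof (rule ccontr)
    assume "\<not> \<delta> > 0"
    then consider "\<delta> = 0" | "\<delta> < 0" by linarith
    thus False
    proof cases
      case 1
      thus False using zero L1 pos by simp
    next
      case 2
      thus False using dirichlet_L_nonzero_right_of_1[OF assms(7,9), of "of_real (1 - \<delta>)"] zero by simp
    qed
  qed
  hence "Re (dirichlet_L D chiD 1) < \<delta> * (ln U)\<^sup>2"
    using dirichlet_L_1_less_of_zero[OF assms(7,9) _ zero U] by blast
  with L1 have "c\<^sub>1 / (U powr (b * \<gamma>) * ln U ^ 3) < \<delta> * (ln U)\<^sup>2" by linarith
  hence "c\<^sub>1 / (U powr (b * \<gamma>) * ln U ^ 3) / (ln U)\<^sup>2 < \<delta>"
    using y by (subst pos_divide_less_eq) auto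
  moreover have "ln U ^ 5 = ln U ^ 3 * (ln U)\<^sup>2" by (simp flip: power_add)
  ultimately show ?thesis by (simp only: divide_divide_eq_left mult.assoc)
qed

end
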